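(* Let $g_1,g_2\in C(\Omega)$, $\varrho(g_1,g_2):=\|g_1-g_2\|_\infty$, and let $p_{\tau,j}$ denote the Lebesgue density of $\pi_\tau(\cdot\mid g_j)$, $j=1,2$. For every $\theta\in\Omega$ and $\tau>0$, $$\left|\log p_{\tau,1}(\theta)-\log p_{\tau,2}(\theta)\right|\le 2\varrho(g_1,g_2)/\tau,\qquad \mathrm{TV}\{\pi_\tau(\cdot\mid g_1),\pi_\tau(\cdot\mid g_2)\}\le\tanh\{\varrho(g_1,g_2)/\tau\}.$$ Consequently, for any Borel probability laws $\mathbb Q_1,\mathbb Q_2$ on $C(\Omega)$ with $\int_{C(\Omega)}\|g\|_\infty\,\mathbb Q_j(dg)<\infty$, $j=1,2$, $$\mathrm{TV}\{\mathcal A_\tau(\mathbb Q_1),\mathcal A_\tau(\mathbb Q_2)\}\le W_{1,\infty}(\mathbb Q_1,\mathbb Q_2)/\tau.$$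
   Context: $\Omega\subset\mathbb R^d$ is compact and convex with nonempty interior; $\lambda$ is Lebesgue measure. $C(\Omega)$ carries the supremum norm and its Borel $\sigma$-algebra. For $g\in C(\Omega)$ and $\tau>0$, $\pi_\tau(d\theta\mid g)=\exp\{g(\theta)/\tau\}\lambda(d\theta)/\mathcal Z_\tau(g)$ with $\mathcal Z_\tau(g)=\int_\Omega\exp\{g(u)/\tau\}\lambda(du)$. For a Borel probability law $\mathbb Q$ on $C(\Omega)$, $\mathcal A_\tau(\mathbb Q)(A)=\int_{C(\Omega)}\pi_\tau(A\mid g)\,\mathbb Q(dg)$, $A\in\mathscr B(\Omega)$. $\mathrm{TV}(\pi,\rho)=\sup_{A\in\mathscr B(\Omega)}|\pi(A)-\rho(A)|$. $W_{1,\infty}(\mathbb Q_1,\mathbb Q_2)=\inf_\gamma\int\|g_1-g_2\|_\infty\,\gamma(dg_1,dg_2)$, the infimum being over all couplings $\gamma$ of $\mathbb Q_1$ and $\mathbb Q_2$ on $C(\Omega)\times C(\Omega)$. *)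

theory Defs
  imports "HOL-Probability.Probability"
begin

(* Elements of C(Omega) are total functions in HOL; requiring them to be extensional on Omega
   (value undefined outside) makes equality of elements the same as equality on Omega. *)
definition C_space :: "'a::euclidean_space set \<Rightarrow> ('a \<Rightarrow> real) set" where
  "C_space \<Omega> = {g. continuous_on \<Omega> g \<and> g \<in> extensional \<Omega>}"

definition sup_norm :: "'a set \<Rightarrow> ('a \<Rightarrow> real) \<Rightarrow> real" where
  "sup_norm \<Omega> g = (SUP x\<in>\<Omega>. \<bar>g x\<bar>)"

(* The value 0 outside the carrier is only there because the library asks metrics to be
   nonnegative and symmetric on the whole type. *)
definition C_dist :: "'a::euclidean_space set \<Rightarrow> ('a \<Rightarrow> real) \<Rightarrow> ('a \<Rightarrow> real) \<Rightarrow> real" where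
  "C_dist \<Omega> f g =
     (if f \<in> C_space \<Omega> \<and> g \<in> C_space \<Omega> then sup_norm \<Omega> (\<lambda>x. f x - g x) else 0)"

definition C_metric :: "'a::euclidean_space set \<Rightarrow> ('a \<Rightarrow> real) metric" where
  "C_metric \<Omega> = metric (C_space \<Omega>, C_dist \<Omega>)"

definition C_borel :: "'a::euclidean_space set \<Rightarrow> ('a \<Rightarrow> real) measure" where
  "C_borel \<Omega> = sigma (C_space \<Omega>) {U. openin (mtopology_of (C_metric \<Omega>)) U}"

definition partition_fun :: "'a::euclidean_space set \<Rightarrow> real \<Rightarrow> ('a \<Rightarrow> real) \<Rightarrow> real" where
  "partition_fun \<Omega> \<tau> g = (\<integral>u. exp (g u / \<tau>) \<partial>restrict_space lborel \<Omega>)"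

definition gibbs_density :: "'a::euclidean_space set \<Rightarrow> real \<Rightarrow> ('a \<Rightarrow> real) \<Rightarrow> 'a \<Rightarrow> real" where
  "gibbs_density \<Omega> \<tau> g \<theta> = exp (g \<theta> / \<tau>) / partition_fun \<Omega> \<tau> g"

definition gibbs :: "'a::euclidean_space set \<Rightarrow> real \<Rightarrow> ('a \<Rightarrow> real) \<Rightarrow> 'a measure" where
  "gibbs \<Omega> \<tau> g = density (restrict_space lborel \<Omega>) (\<lambda>\<theta>. ennreal (gibbs_density \<Omega> \<tau> g \<theta>))"

(* For a law Q on C(Omega) the set function below is countably additive, because
   g |-> gibbs(g)(A) is continuous for every Borel A; hence measure_of does not degenerate
   to the null measure. *)
definition gibbs_mixture ::
    "'a::euclidean_space set \<Rightarrow> real \<Rightarrow> ('a \<Rightarrow> real) measure \<Rightarrow> 'a measure" where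
  "gibbs_mixture \<Omega> \<tau> Q =
     measure_of \<Omega> (sets (restrict_space borel \<Omega>)) (\<lambda>A. \<integral>\<^sup>+ g. emeasure (gibbs \<Omega> \<tau> g) A \<partial>Q)"

definition total_variation :: "'a::euclidean_space set \<Rightarrow> 'a measure \<Rightarrow> 'a measure \<Rightarrow> real" where
  "total_variation \<Omega> P R =
     (SUP A\<in>sets (restrict_space borel \<Omega>). \<bar>measure P A - measure R A\<bar>)"

(* For compact Omega, C(Omega) is separable, so the product sigma-algebra used here is the
   Borel sigma-algebra of C(Omega) x C(Omega). *)
definition couplings :: "'a::euclidean_space set \<Rightarrow> ('a \<Rightarrow> real) measure \<Rightarrow> ('a \<Rightarrow> real) measure
    \<Rightarrow> (('a \<Rightarrow> real) \<times> ('a \<Rightarrow> real)) measure set" where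
  "couplings \<Omega> Q1 Q2 =
     {\<gamma>. prob_space \<gamma> \<and> sets \<gamma> = sets (C_borel \<Omega> \<Otimes>\<^sub>M C_borel \<Omega>) \<and>
         distr \<gamma> (C_borel \<Omega>) fst = Q1 \<and> distr \<gamma> (C_borel \<Omega>) snd = Q2}"

definition wasserstein_sup ::
    "'a::euclidean_space set \<Rightarrow> ('a \<Rightarrow> real) measure \<Rightarrow> ('a \<Rightarrow> real) measure \<Rightarrow> ennreal" where
  "wasserstein_sup \<Omega> Q1 Q2 =
     (INF \<gamma>\<in>couplings \<Omega> Q1 Q2.
        \<integral>\<^sup>+ (g1, g2). ennreal (sup_norm \<Omega> (\<lambda>x. g1 x - g2 x)) \<partial>\<gamma>)"

lemma bdd_above_abs_compact:
  fixes h :: "'a::euclidean_space \<Rightarrow> real"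
  assumes "compact \<Omega>" "continuous_on \<Omega> h"
  shows "bdd_above ((\<lambda>x. \<bar>h x\<bar>) ` \<Omega>)"
proof -
  have "compact ((\<lambda>x. \<bar>h x\<bar>) ` \<Omega>)"
    using assms by (intro compact_continuous_image continuous_intros)
  then show ?thesis
    by (simp add: bounded_imp_bdd_above compact_imp_bounded)
qed

lemma Metric_space_C_space:
  fixes \<Omega> :: "'a::euclidean_space set"
  assumes "compact \<Omega>" "\<Omega> \<noteq> {}"
  shows "Metric_space (C_space \<Omega>) (C_dist \<Omega>)"
proof -
  have bdd: "bdd_above ((\<lambda>x. \<bar>f x - g x\<bar>) ` \<Omega>)"
    if "f \<in> C_space \<Omega>" "g \<in> C_space \<Omega>" for f g
    using that assms(1)
    by (intro bdd_above_abs_compact continuous_on_diff) (simp_all add: C_space_def)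
  have le: "\<bar>f x - g x\<bar> \<le> C_dist \<Omega> f g"
    if "f \<in> C_space \<Omega>" "g \<in> C_space \<Omega>" "x \<in> \<Omega>" for f g x
    using cSUP_upper[OF that(3) bdd[OF that(1,2)]] that by (simp add: C_dist_def sup_norm_def)
  show ?thesis
  proof
    fix f g
    show "0 \<le> C_dist \<Omega> f g"
    proof (cases "f \<in> C_space \<Omega> \<and> g \<in> C_space \<Omega>")
      case True
      obtain x where "x \<in> \<Omega>" using assms by blast
      then show ?thesis using le[of f g x] True by linarith
    qed (auto simp: C_dist_def)
    show "C_dist \<Omega> f g = C_dist \<Omega> g f"
      by (simp add: C_dist_def sup_norm_def abs_minus_commute)
  next
    fix f g assume fg: "f \<in> C_space \<Omega>" "g \<in> C_space \<Omega>"
    show "C_dist \<Omega> f g = 0 \<longleftrightarrow> f = g"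
    proof
      assume "C_dist \<Omega> f g = 0"
      then have "f x = g x" if "x \<in> \<Omega>" for x
        using le[OF fg that] by simp
      then show "f = g"
        using fg extensionalityI[of f \<Omega> g] by (simp add: C_space_def)
    qed (use assms in \<open>simp add: C_dist_def sup_norm_def\<close>)
  next
    fix f g h assume fgh: "f \<in> C_space \<Omega>" "g \<in> C_space \<Omega>" "h \<in> C_space \<Omega>"
    have "\<bar>f x - h x\<bar> \<le> C_dist \<Omega> f g + C_dist \<Omega> g h" if "x \<in> \<Omega>" for x
      using le[OF fgh(1,2) that] le[OF fgh(2,3) that] by linarith
    then have "(SUP x\<in>\<Omega>. \<bar>f x - h x\<bar>) \<le> C_dist \<Omega> f g + C_dist \<Omega> g h"
      using assms by (intro cSUP_least) auto
    then show "C_dist \<Omega> f h \<le> C_dist \<Omega> f g + C_dist \<Omega> g h"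
      using fgh by (simp add: C_dist_def sup_norm_def)
  qed
qed

lemma mspace_C_metric: "compact \<Omega> \<Longrightarrow> \<Omega> \<noteq> {} \<Longrightarrow> mspace (C_metric \<Omega>) = C_space \<Omega>"
  unfolding C_metric_def by (rule Metric_space.mspace_metric[OF Metric_space_C_space])

lemma mdist_C_metric: "compact \<Omega> \<Longrightarrow> \<Omega> \<noteq> {} \<Longrightarrow> mdist (C_metric \<Omega>) = C_dist \<Omega>"
  unfolding C_metric_def by (rule Metric_space.mdist_metric[OF Metric_space_C_space])

end

theory Submission
  imports Defs
begin

text \<open>
  Write \<open>s\<close> for the sup distance of the two functions divided by \<open>\<tau>\<close>. Pointwise, hence after integration
  over any Borel set, the two unnormalised Gibbs weights differ by a factor of at most \<open>exp s\<close>. Applied to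
  \<open>\<Omega>\<close> this gives the bound on log densities; applied to a set and to its complement it shows that the
  odds of the set differ by a factor of at most \<open>k = exp (2 s)\<close>, so the probabilities differ by at most
  \<open>(k - 1) / (k + 1) = tanh s\<close>. As \<open>tanh s \<le> s\<close>, the probability of a fixed Borel set is a Lipschitz, hence
  measurable, function of \<open>g\<close>, and integrating its increments against a coupling gives the last claim.
\<close>

section \<open>Elementary inequalities for tanh\<close>

text \<open>The function \<open>x - tanh x\<close> vanishes at 0 and has derivative
  \<open>1 - (1 - tanh x ^ 2) = tanh x ^ 2\<close>, which is nonnegative.\<close>

lemma tanh_le_self:
  fixes x :: real
  assumes "0 \<le> x"
  shows "tanh x \<le> x"
proof -
  have "0 - tanh 0 \<le> x - tanh x"
  proof (rule DERIV_nonneg_imp_nondecreasing[OF assms])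
    fix y :: real
    have "((\<lambda>x. x - tanh x) has_real_derivative tanh y ^ 2) (at y)"
      by (auto intro!: derivative_eq_intros)
    then show "\<exists>d. ((\<lambda>x. x - tanh x) has_real_derivative d) (at y) \<and> 0 \<le> d"
      by (intro exI conjI) auto
  qed
  then show ?thesis by simp
qed

text \<open>Over the common denominator \<open>Z\<close> the difference of the two shares has
  numerator \<open>x - y\<close>. The two comparisons multiply to \<open>x \<le> k * y\<close>, an
  odds ratio of at most \<open>k = exp (2 * s)\<close>. Only the two comparisons that push the
  difference upwards appear; the other sign comes from exchanging the indices.\<close>

lemma share_diff_le_tanh:
  fixes a1 b1 a2 b2 s :: real
  assumes nonneg: "0 \<le> a1" "0 \<le> b1" "0 \<le> a2" "0 \<le> b2"
    and pos: "0 < a1 + b1" "0 < a2 + b2" and s: "0 \<le> s"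
    and le: "a1 \<le> exp s * a2" "b2 \<le> exp s * b1"
  shows "a1 / (a1 + b1) - a2 / (a2 + b2) \<le> tanh s"
proof -
  define x y k Z where "x = a1 * b2" and "y = a2 * b1" and "k = exp s * exp s"
    and "Z = (a1 + b1) * (a2 + b2)"
  have k: "1 \<le> k" "0 < k"
    using s mult_mono[of 1 "exp s" 1 "exp s"] by (auto simp: k_def)
  have "x \<le> (exp s * a2) * (exp s * b1)"
    unfolding x_def by (intro mult_mono le) (use nonneg in auto)
  then have xy: "x \<le> k * y"
    by (simp add: k_def y_def mult_ac)
  \<comment> \<open>Expanding \<open>Z\<close> gives \<open>x + y\<close> together with the
    nonnegative products \<open>a1 * a2\<close> and \<open>b1 * b2\<close>.\<close>
  have "x + y \<le> Z"
    using nonneg by (simp add: x_def y_def Z_def algebra_simps)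
  then have "(k - 1) * (x + y) \<le> (k - 1) * Z"
    using k by (intro mult_left_mono) auto
  \<comment> \<open>The identity
    \<open>(x - y) * (k + 1) - (k - 1) * (x + y) = 2 * (x - k * y)\<close> reduces this to
    \<open>x \<le> k * y\<close>.\<close>
  then have "(x - y) * (k + 1) \<le> (k - 1) * Z"
    using xy by (simp add: algebra_simps)
  then have "(x - y) / Z \<le> (k - 1) / (k + 1)"
    using k pos by (simp add: Z_def divide_simps mult_ac)
  moreover have "a1 / (a1 + b1) - a2 / (a2 + b2) = (x - y) / Z"
    using pos unfolding x_def y_def Z_def by (simp add: divide_simps) (simp add: algebra_simps)
  moreover have "tanh s = (k - 1) / (k + 1)"
  proof -
    have "exp (- 2 * s) = 1 / k"
      by (simp add: k_def exp_minus field_simps flip: exp_add)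
    then have "tanh s = (1 - 1 / k) / (1 + 1 / k)"
      by (simp only: tanh_real_altdef)
    also have "\<dots> = (k - 1) / (k + 1)"
      using k by (simp add: divide_simps)
    finally show ?thesis .
  qed
  ultimately show ?thesis by simp
qed

text \<open>A supremum of reals dominates the values only when these are bounded above; compactness
  and continuity provide the bound.\<close>

lemma abs_diff_le_sup_norm:
  assumes "compact \<Omega>" "f \<in> C_space \<Omega>" "g \<in> C_space \<Omega>" "x \<in> \<Omega>"
  shows "\<bar>f x - g x\<bar> \<le> sup_norm \<Omega> (\<lambda>x. f x - g x)"
proof -
  have "continuous_on \<Omega> (\<lambda>x. f x - g x)"
    using assms by (intro continuous_on_diff) (simp_all add: C_space_def)
  then show ?thesis
    unfolding sup_norm_def using assms by (intro cSUP_upper bdd_above_abs_compact)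
qed

lemma sup_norm_diff_commute: "sup_norm \<Omega> (\<lambda>x. f x - g x) = sup_norm \<Omega> (\<lambda>x. g x - f x)"
  by (simp add: sup_norm_def abs_minus_commute)

context
  fixes \<Omega> :: "'a::euclidean_space set" and \<tau> :: real
  assumes compact: "compact \<Omega>" and interior: "interior \<Omega> \<noteq> {}" and \<tau>: "\<tau> > 0"
begin

lemma nonempty: "\<Omega> \<noteq> {}"
  using interior interior_subset by blast

section \<open>The Borel sigma-algebra of the space of continuous functions\<close>

lemma space_C_borel: "space (C_borel \<Omega>) = C_space \<Omega>"
  by (simp add: C_borel_def space_measure_of_conv)

lemma sets_C_borel: "sets (C_borel \<Omega>) = sigma_sets (C_space \<Omega>) {U. openin (mtopology_of (C_metric \<Omega>)) U}"
  unfolding C_borel_def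
proof (rule sets_measure_of)
  show "{U. openin (mtopology_of (C_metric \<Omega>)) U} \<subseteq> Pow (C_space \<Omega>)"
    using openin_subset[of "mtopology_of (C_metric \<Omega>)"]
    by (auto simp: mspace_C_metric[OF compact nonempty])
qed

text \<open>The open sets generate \<open>C_borel\<close>, so it suffices that preimages of open
  sets are open: a ball of radius \<open>e / L\<close> is mapped into an interval of radius
  \<open>e\<close>.\<close>

lemma Lipschitz_borel_measurable:
  fixes F :: "('a \<Rightarrow> real) \<Rightarrow> real"
  assumes Lip: "\<And>f g. f \<in> C_space \<Omega> \<Longrightarrow> g \<in> C_space \<Omega> \<Longrightarrow> \<bar>F f - F g\<bar> \<le> L * sup_norm \<Omega> (\<lambda>x. f x - g x)"
    and L: "0 < L"
  shows "F \<in> borel_measurable (C_borel \<Omega>)"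
proof (rule borel_measurableI)
  interpret C: Metric_space "C_space \<Omega>" "C_dist \<Omega>"
    by (rule Metric_space_C_space[OF compact nonempty])
  fix S :: "real set" assume S: "open S"
  have "openin C.mtopology (F -` S \<inter> C_space \<Omega>)"
    unfolding C.openin_mtopology
  proof (intro conjI allI impI)
    fix f assume f: "f \<in> F -` S \<inter> C_space \<Omega>"
    then obtain e where e: "0 < e" "\<And>y. dist y (F f) < e \<Longrightarrow> y \<in> S"
      using S by (auto simp: open_dist)
    have "g \<in> F -` S \<inter> C_space \<Omega>" if g: "g \<in> C.mball f (e / L)" for g
    proof -
      \<comment> \<open>Membership in the ball puts both functions in the carrier, so
        \<open>C_dist\<close> is the sup norm here and not its default 0.\<close>
      have *: "g \<in> C_space \<Omega>" "sup_norm \<Omega> (\<lambda>x. f x - g x) < e / L"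
        using g by (auto simp: C_dist_def)
      have "\<bar>F f - F g\<bar> < e"
        using Lip[of f g] f * L by (auto simp: field_simps)
      then show ?thesis
        using * e(2)[of "F g"] by (auto simp: dist_real_def abs_minus_commute)
    qed
    then show "\<exists>r>0. C.mball f r \<subseteq> F -` S \<inter> C_space \<Omega>"
      using e L by (intro exI[of _ "e / L"]) auto
  qed auto
  then show "F -` S \<inter> space (C_borel \<Omega>) \<in> sets (C_borel \<Omega>)"
    unfolding space_C_borel sets_C_borel C_metric_def C.mtopology_of
    by (intro sigma_sets.Basic) simp
qed

section \<open>Lebesgue measure on \<open>\<Omega>\<close> and unnormalised Gibbs weights\<close>

abbreviation base_measure :: "'a measure" where
  "base_measure \<equiv> restrict_space lborel \<Omega>"

lemma sets_base: "sets base_measure = sets (restrict_space borel \<Omega>)"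
  by (simp add: sets_restrict_space)

lemma Omega_borel [measurable]: "\<Omega> \<in> sets borel"
  using compact by (simp add: borel_compact)

lemma space_base: "space base_measure = \<Omega>"
  by (simp add: space_restrict_space)

text \<open>An interior point yields a ball inside \<open>\<Omega>\<close>, and balls have positive
  volume. This is what keeps the partition function away from 0.\<close>

lemma emeasure_base_pos: "emeasure base_measure \<Omega> \<noteq> 0"
proof -
  obtain x e where x: "0 < e" "ball x e \<subseteq> \<Omega>"
    using interior by (meson all_not_in_conv mem_interior)
  have "0 < emeasure lborel (ball x e)"
    using x by (simp add: emeasure_ball unit_ball_vol_pos)
  also have "\<dots> \<le> emeasure lborel \<Omega>"
    using x by (intro emeasure_mono) auto
  finally show ?thesis by (simp add: emeasure_restrict_space)
qed

lemma integrable_exp: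
  assumes "g \<in> C_space \<Omega>"
  shows "integrable base_measure (\<lambda>u. exp (g u / \<tau>))"
proof -
  have "continuous_on \<Omega> (\<lambda>u. exp (g u / \<tau>))"
    using assms \<tau> by (intro continuous_intros) (auto simp: C_space_def)
  then show ?thesis
    using borel_integrable_compact[OF compact, of "\<lambda>u. exp (g u / \<tau>)"]
    by (subst integrable_restrict_space) simp_all
qed

lemma integrable_exp_indicator:
  assumes "g \<in> C_space \<Omega>" "A \<in> sets base_measure"
  shows "integrable base_measure (\<lambda>u. indicator A u * exp (g u / \<tau>))"
  using integrable_mult_indicator[OF assms(2) integrable_exp[OF assms(1)]] by simp

text \<open>The numerator of the Gibbs probability of \<open>A\<close>. Comparing numerators before
  normalising is what gives access to the odds of \<open>A\<close>.\<close>

definition weight :: "('a \<Rightarrow> real) \<Rightarrow> 'a set \<Rightarrow> real" where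
  "weight g A = (\<integral>u. indicator A u * exp (g u / \<tau>) \<partial>base_measure)"

lemma weight_nonneg: "0 \<le> weight g A"
  unfolding weight_def by (intro integral_nonneg_AE) auto

text \<open>The integral of a nonnegative function vanishes only if the function is zero almost
  everywhere; as \<open>exp\<close> has no zeros, \<open>\<Omega>\<close> would then be a null
  set.\<close>

lemma partition_fun_pos:
  assumes "g \<in> C_space \<Omega>"
  shows "0 < partition_fun \<Omega> \<tau> g"
proof -
  have "partition_fun \<Omega> \<tau> g \<noteq> 0"
  proof
    assume "partition_fun \<Omega> \<tau> g = 0"
    then have "AE u in base_measure. exp (g u / \<tau>) = 0"
      unfolding partition_fun_def
      by (subst (asm) integral_nonneg_eq_0_iff_AE) (use integrable_exp[OF assms] in auto)
    then have "AE u in base_measure. u \<notin> \<Omega>"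
      by (rule AE_mp) (rule AE_I2, simp)
    then have "\<Omega> \<in> null_sets base_measure"
      using sets.top[of base_measure] by (subst AE_iff_null_sets) (simp_all add: space_base)
    then show False using emeasure_base_pos by auto
  qed
  moreover have "0 \<le> partition_fun \<Omega> \<tau> g"
    unfolding partition_fun_def by (intro integral_nonneg_AE) auto
  ultimately show ?thesis by simp
qed

text \<open>Brings the Gibbs probability of \<open>A\<close> into the form
  \<open>a / (a + b)\<close> required by \<open>share_diff_le_tanh\<close>.\<close>

lemma partition_fun_split:
  assumes "g \<in> C_space \<Omega>" "A \<in> sets base_measure"
  shows "partition_fun \<Omega> \<tau> g = weight g A + weight g (\<Omega> - A)"
proof -
  have "\<Omega> - A \<in> sets base_measure"
    using sets.compl_sets[OF assms(2)] by (simp add: space_base)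
  then have "weight g A + weight g (\<Omega> - A) =
      (\<integral>u. indicator A u * exp (g u / \<tau>) + indicator (\<Omega> - A) u * exp (g u / \<tau>) \<partial>base_measure)"
    unfolding weight_def by (intro Bochner_Integration.integral_add[symmetric] integrable_exp_indicator assms)
  also have "\<dots> = partition_fun \<Omega> \<tau> g"
    unfolding partition_fun_def
    by (intro Bochner_Integration.integral_cong) (auto simp: space_base indicator_def)
  finally show ?thesis by simp
qed

lemma exp_le_exp_sup_norm:
  assumes "f \<in> C_space \<Omega>" "g \<in> C_space \<Omega>" "x \<in> \<Omega>"
  shows "exp (f x / \<tau>) \<le> exp (sup_norm \<Omega> (\<lambda>x. f x - g x) / \<tau>) * exp (g x / \<tau>)"
proof -
  have "f x / \<tau> \<le> (sup_norm \<Omega> (\<lambda>x. f x - g x) + g x) / \<tau>"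
    using abs_diff_le_sup_norm[OF compact assms] \<tau> by (intro divide_right_mono) auto
  then show ?thesis by (simp add: add_divide_distrib flip: exp_add)
qed

text \<open>The pointwise comparison of the exponentials is integrated over \<open>A\<close>.
  Exchanging \<open>f\<close> and \<open>g\<close> gives the reverse comparison with the same
  factor.\<close>

lemma weight_le:
  assumes "f \<in> C_space \<Omega>" "g \<in> C_space \<Omega>" "A \<in> sets base_measure"
  shows "weight f A \<le> exp (sup_norm \<Omega> (\<lambda>x. f x - g x) / \<tau>) * weight g A"
proof -
  define c where "c = exp (sup_norm \<Omega> (\<lambda>x. f x - g x) / \<tau>)"
  have "weight f A \<le> (\<integral>u. c * (indicator A u * exp (g u / \<tau>)) \<partial>base_measure)"
    unfolding weight_def
  proof (intro integral_mono integrable_exp_indicator integrable_mult_right assms)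
    fix x assume "x \<in> space base_measure"
    then show "indicator A x * exp (f x / \<tau>) \<le> c * (indicator A x * exp (g x / \<tau>))"
      using exp_le_exp_sup_norm[OF assms(1,2)] by (simp add: space_base indicator_def c_def)
  qed
  then show ?thesis by (simp add: weight_def c_def)
qed

lemma partition_fun_eq_weight: "partition_fun \<Omega> \<tau> g = weight g \<Omega>"
  unfolding partition_fun_def weight_def
  by (intro Bochner_Integration.integral_cong) (auto simp: space_base)

section \<open>The bound on log densities\<close>

text \<open>The factor 2 counts two contributions of at most the sup distance divided by
  \<open>\<tau>\<close>: one from the exponent at \<open>\<theta>\<close>, one from the logarithm of
  the partition function.\<close>

lemma abs_ln_gibbs_density_diff_le:
  assumes f: "f \<in> C_space \<Omega>" and g: "g \<in> C_space \<Omega>" and \<theta>: "\<theta> \<in> \<Omega>"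
  shows "\<bar>ln (gibbs_density \<Omega> \<tau> f \<theta>) - ln (gibbs_density \<Omega> \<tau> g \<theta>)\<bar>
           \<le> 2 * sup_norm \<Omega> (\<lambda>x. f x - g x) / \<tau>"
proof -
  have ln_eq: "ln (gibbs_density \<Omega> \<tau> h \<theta>) = h \<theta> / \<tau> - ln (partition_fun \<Omega> \<tau> h)"
    if "h \<in> C_space \<Omega>" for h
    using partition_fun_pos[OF that] by (simp add: gibbs_density_def ln_div)
  \<comment> \<open>This is the logarithm of \<open>weight_le\<close> on the whole of
    \<open>\<Omega>\<close>. It is kept general in \<open>h\<close> and \<open>k\<close> because
    both orders are needed for the absolute value.\<close>
  have ln_le: "ln (partition_fun \<Omega> \<tau> h) \<le> sup_norm \<Omega> (\<lambda>x. h x - k x) / \<tau> + ln (partition_fun \<Omega> \<tau> k)"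
    if hk: "h \<in> C_space \<Omega>" "k \<in> C_space \<Omega>" for h k
  proof -
    have \<Omega>: "\<Omega> \<in> sets base_measure"
      using sets.top[of base_measure] by (simp add: space_base)
    have "ln (partition_fun \<Omega> \<tau> h) \<le> ln (exp (sup_norm \<Omega> (\<lambda>x. h x - k x) / \<tau>) * partition_fun \<Omega> \<tau> k)"
      using weight_le[OF hk \<Omega>] partition_fun_pos[OF hk(1)] partition_fun_pos[OF hk(2)]
      by (subst ln_le_cancel_iff) (auto simp: partition_fun_eq_weight)
    then show ?thesis
      using partition_fun_pos[OF hk(2)] by (simp add: ln_mult)
  qed
  have "\<bar>f \<theta> / \<tau> - g \<theta> / \<tau>\<bar> \<le> sup_norm \<Omega> (\<lambda>x. f x - g x) / \<tau>"
    using abs_diff_le_sup_norm[OF compact f g \<theta>] \<tau>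
    by (simp add: divide_right_mono flip: diff_divide_distrib)
  then show ?thesis
    using ln_le[OF f g] ln_le[OF g f] sup_norm_diff_commute[of \<Omega> f g]
    unfolding ln_eq[OF f] ln_eq[OF g] by simp
qed

section \<open>Gibbs probabilities of Borel sets and the total variation bound\<close>

lemma sets_gibbs: "sets (gibbs \<Omega> \<tau> g) = sets base_measure"
  by (simp add: gibbs_def)

text \<open>The density is nonnegative and integrable, so its extended-real integral is a quotient
  of real integrals, to which the weight comparisons apply.\<close>

lemma emeasure_gibbs:
  assumes "g \<in> C_space \<Omega>" "A \<in> sets base_measure"
  shows "emeasure (gibbs \<Omega> \<tau> g) A = ennreal (weight g A / partition_fun \<Omega> \<tau> g)"
proof -
  note [measurable] = borel_measurable_integrable[OF integrable_exp[OF assms(1)]]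
  have "emeasure (gibbs \<Omega> \<tau> g) A = (\<integral>\<^sup>+u. ennreal (gibbs_density \<Omega> \<tau> g u) * indicator A u \<partial>base_measure)"
    unfolding gibbs_def gibbs_density_def by (intro emeasure_density assms) measurable
  also have "\<dots> = (\<integral>\<^sup>+u. ennreal (indicator A u * exp (g u / \<tau>) / partition_fun \<Omega> \<tau> g) \<partial>base_measure)"
    by (intro nn_integral_cong) (simp add: gibbs_density_def indicator_def)
  also have "\<dots> = ennreal (\<integral>u. indicator A u * exp (g u / \<tau>) / partition_fun \<Omega> \<tau> g \<partial>base_measure)"
    using partition_fun_pos[OF assms(1)]
    by (intro nn_integral_eq_integral integrable_divide integrable_exp_indicator assms) auto
  finally show ?thesis by (simp add: weight_def)
qed

lemma measure_gibbs:
  assumes "g \<in> C_space \<Omega>" "A \<in> sets base_measure"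
  shows "measure (gibbs \<Omega> \<tau> g) A = weight g A / partition_fun \<Omega> \<tau> g"
  using emeasure_gibbs[OF assms] weight_nonneg[of g A] partition_fun_pos[OF assms(1)]
  by (simp add: measure_def)

lemma emeasure_gibbs_eq_measure:
  assumes "g \<in> C_space \<Omega>" "A \<in> sets base_measure"
  shows "emeasure (gibbs \<Omega> \<tau> g) A = ennreal (measure (gibbs \<Omega> \<tau> g) A)"
  by (simp only: emeasure_gibbs measure_gibbs assms)

lemma measure_gibbs_le_1:
  assumes "g \<in> C_space \<Omega>" "A \<in> sets base_measure"
  shows "measure (gibbs \<Omega> \<tau> g) A \<le> 1"
  using partition_fun_split[OF assms] weight_nonneg[of g "\<Omega> - A"] partition_fun_pos[OF assms(1)]
  by (simp add: measure_gibbs assms)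

lemma sup_norm_diff_nonneg:
  assumes "f \<in> C_space \<Omega>" "g \<in> C_space \<Omega>"
  shows "0 \<le> sup_norm \<Omega> (\<lambda>x. f x - g x)"
proof -
  obtain x where "x \<in> \<Omega>" using nonempty by blast
  from abs_diff_le_sup_norm[OF compact assms this] show ?thesis by linarith
qed

text \<open>\<open>share_diff_le_tanh\<close> is applied to the weights of \<open>A\<close> and of
  its complement, once for each order of the two functions.\<close>

lemma abs_measure_gibbs_diff_le_tanh:
  assumes f: "f \<in> C_space \<Omega>" and g: "g \<in> C_space \<Omega>" and A: "A \<in> sets base_measure"
  shows "\<bar>measure (gibbs \<Omega> \<tau> f) A - measure (gibbs \<Omega> \<tau> g) A\<bar>
           \<le> tanh (sup_norm \<Omega> (\<lambda>x. f x - g x) / \<tau>)"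
proof -
  have A': "\<Omega> - A \<in> sets base_measure"
    using sets.compl_sets[OF A] by (simp add: space_base)
  have "measure (gibbs \<Omega> \<tau> h) A - measure (gibbs \<Omega> \<tau> k) A \<le> tanh (sup_norm \<Omega> (\<lambda>x. h x - k x) / \<tau>)"
    if h: "h \<in> C_space \<Omega>" and k: "k \<in> C_space \<Omega>" for h k
    unfolding measure_gibbs[OF h A] measure_gibbs[OF k A]
      partition_fun_split[OF h A] partition_fun_split[OF k A]
  proof (rule share_diff_le_tanh)
    show "0 < weight h A + weight h (\<Omega> - A)" "0 < weight k A + weight k (\<Omega> - A)"
      using partition_fun_pos[OF h] partition_fun_pos[OF k]
      by (simp_all add: partition_fun_split[OF h A] partition_fun_split[OF k A])
    show "0 \<le> sup_norm \<Omega> (\<lambda>x. h x - k x) / \<tau>"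
      using sup_norm_diff_nonneg[OF h k] \<tau> by simp
    \<comment> \<open>On the complement the comparison runs the other way: the upper bound needs
      \<open>a1\<close> controlled by \<open>a2\<close>, but \<open>b2\<close> by
      \<open>b1\<close>.\<close>
    show "weight k (\<Omega> - A) \<le> exp (sup_norm \<Omega> (\<lambda>x. h x - k x) / \<tau>) * weight h (\<Omega> - A)"
      using weight_le[OF k h A'] by (simp only: sup_norm_diff_commute[of \<Omega> k h])
  qed (simp_all add: weight_nonneg weight_le h k A)
  from this[OF f g] this[OF g f] show ?thesis
    by (simp add: sup_norm_diff_commute[of \<Omega> g f] abs_le_iff)
qed

lemma total_variation_gibbs_le:
  assumes "f \<in> C_space \<Omega>" "g \<in> C_space \<Omega>"
  shows "total_variation \<Omega> (gibbs \<Omega> \<tau> f) (gibbs \<Omega> \<tau> g) \<le> tanh (sup_norm \<Omega> (\<lambda>x. f x - g x) / \<tau>)"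
  unfolding total_variation_def sets_base[symmetric]
  \<comment> \<open>The empty set witnesses that the supremum is over a nonempty family.\<close>
  using sets.empty_sets by (intro cSUP_least abs_measure_gibbs_diff_le_tanh assms) blast+

text \<open>The linear form of the bound serves twice: as the Lipschitz condition behind
  measurability, and as the estimate against the linear transport cost.\<close>

lemma abs_measure_gibbs_diff_le:
  assumes f: "f \<in> C_space \<Omega>" and g: "g \<in> C_space \<Omega>" and A: "A \<in> sets base_measure"
  shows "\<bar>measure (gibbs \<Omega> \<tau> f) A - measure (gibbs \<Omega> \<tau> g) A\<bar> \<le> sup_norm \<Omega> (\<lambda>x. f x - g x) / \<tau>"
proof -
  have "0 \<le> sup_norm \<Omega> (\<lambda>x. f x - g x) / \<tau>"
    using sup_norm_diff_nonneg[OF f g] \<tau> by simp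
  from tanh_le_self[OF this] abs_measure_gibbs_diff_le_tanh[OF f g A] show ?thesis by linarith
qed

lemma measurable_measure_gibbs:
  assumes "A \<in> sets base_measure"
  shows "(\<lambda>g. measure (gibbs \<Omega> \<tau> g) A) \<in> borel_measurable (C_borel \<Omega>)"
  using \<tau> abs_measure_gibbs_diff_le[OF _ _ assms]
  by (intro Lipschitz_borel_measurable[where L = "1 / \<tau>"]) auto

section \<open>Mixtures of Gibbs measures and couplings\<close>

text \<open>\<open>measure_of\<close> returns the prescribed values only for a countably additive
  set function. Additivity holds for each \<open>g\<close>, and the sum may be exchanged with the
  integral over \<open>Q\<close> because the summands are nonnegative and measurable in
  \<open>g\<close>.\<close>

lemma emeasure_gibbs_mixture:
  assumes Q: "sets Q = sets (C_borel \<Omega>)" and A: "A \<in> sets base_measure"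
  shows "emeasure (gibbs_mixture \<Omega> \<tau> Q) A = (\<integral>\<^sup>+ g. emeasure (gibbs \<Omega> \<tau> g) A \<partial>Q)"
  unfolding gibbs_mixture_def
proof (rule emeasure_measure_of_sigma)
  have spQ: "space Q = C_space \<Omega>"
    using sets_eq_imp_space_eq[OF Q] by (simp add: space_C_borel)
  show "sigma_algebra \<Omega> (sets (restrict_space borel \<Omega>))"
    using sets.sigma_algebra_axioms[of base_measure] by (simp add: sets_base space_base)
  show "positive (sets (restrict_space borel \<Omega>)) (\<lambda>A. \<integral>\<^sup>+ g. emeasure (gibbs \<Omega> \<tau> g) A \<partial>Q)"
    by (simp add: positive_def)
  show "countably_additive (sets (restrict_space borel \<Omega>)) (\<lambda>A. \<integral>\<^sup>+ g. emeasure (gibbs \<Omega> \<tau> g) A \<partial>Q)"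
  proof (rule countably_additiveI)
    fix B :: "nat \<Rightarrow> 'a set"
    assume B: "range B \<subseteq> sets (restrict_space borel \<Omega>)" "disjoint_family B"
    \<comment> \<open>On the space of \<open>Q\<close> the extended-real value agrees with the real
      probability, which is Lipschitz and hence measurable.\<close>
    have "(\<lambda>g. emeasure (gibbs \<Omega> \<tau> g) (B i)) \<in> borel_measurable Q" for i
    proof (subst measurable_cong)
      have Bi: "B i \<in> sets base_measure" using B(1) by (auto simp: sets_base)
      show "(\<lambda>g. ennreal (measure (gibbs \<Omega> \<tau> g) (B i))) \<in> borel_measurable Q"
        using measurable_measure_gibbs[OF Bi] measurable_cong_sets[OF Q refl] by auto
      show "emeasure (gibbs \<Omega> \<tau> g) (B i) = ennreal (measure (gibbs \<Omega> \<tau> g) (B i))" if "g \<in> space Q" for g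
        using that Bi by (intro emeasure_gibbs_eq_measure) (auto simp: spQ)
    qed
    then have "(\<Sum>i. \<integral>\<^sup>+ g. emeasure (gibbs \<Omega> \<tau> g) (B i) \<partial>Q) =
        (\<integral>\<^sup>+ g. (\<Sum>i. emeasure (gibbs \<Omega> \<tau> g) (B i)) \<partial>Q)"
      by (intro nn_integral_suminf[symmetric])
    also have "\<dots> = (\<integral>\<^sup>+ g. emeasure (gibbs \<Omega> \<tau> g) (\<Union>i. B i) \<partial>Q)"
      using B by (intro nn_integral_cong suminf_emeasure) (auto simp: sets_gibbs sets_base)
    finally show "(\<Sum>i. \<integral>\<^sup>+ g. emeasure (gibbs \<Omega> \<tau> g) (B i) \<partial>Q) =
        (\<integral>\<^sup>+ g. emeasure (gibbs \<Omega> \<tau> g) (\<Union>i. B i) \<partial>Q)" .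
  qed
  show "A \<in> sets (restrict_space borel \<Omega>)"
    using A by (simp add: sets_base)
qed

lemma integrable_measure_gibbs:
  assumes "prob_space Q" and Q: "sets Q = sets (C_borel \<Omega>)" and A: "A \<in> sets base_measure"
  shows "integrable Q (\<lambda>g. measure (gibbs \<Omega> \<tau> g) A)"
proof -
  interpret prob_space Q by fact
  have "space Q = C_space \<Omega>"
    using sets_eq_imp_space_eq[OF Q] by (simp add: space_C_borel)
  then show ?thesis
    using measurable_measure_gibbs[OF A] measurable_cong_sets[OF Q refl] measure_gibbs_le_1[OF _ A]
    by (intro integrable_const_bound[where B = 1]) auto
qed

text \<open>Passing to a real integral, legitimate because the integrand is integrable, allows
  mixtures to be subtracted.\<close>

lemma measure_gibbs_mixture:
  assumes "prob_space Q" and Q: "sets Q = sets (C_borel \<Omega>)" and A: "A \<in> sets base_measure"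
  shows "measure (gibbs_mixture \<Omega> \<tau> Q) A = (\<integral> g. measure (gibbs \<Omega> \<tau> g) A \<partial>Q)"
proof -
  have "emeasure (gibbs_mixture \<Omega> \<tau> Q) A = (\<integral>\<^sup>+ g. ennreal (measure (gibbs \<Omega> \<tau> g) A) \<partial>Q)"
    unfolding emeasure_gibbs_mixture[OF Q A]
    using sets_eq_imp_space_eq[OF Q] A
    by (intro nn_integral_cong emeasure_gibbs_eq_measure) (auto simp: space_C_borel)
  also have "\<dots> = ennreal (\<integral> g. measure (gibbs \<Omega> \<tau> g) A \<partial>Q)"
    by (intro nn_integral_eq_integral integrable_measure_gibbs assms) auto
  finally show ?thesis
    by (simp add: measure_def integral_nonneg_AE)
qed

text \<open>
  \<open>\<tau>\<close> multiplies the left-hand side because scaling the integral on the right would need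
  measurability of the sup norm on the product space.
\<close>
lemma gibbs_mixture_diff_le_coupling:
  assumes Q1: "prob_space Q1" "sets Q1 = sets (C_borel \<Omega>)"
    and Q2: "prob_space Q2" "sets Q2 = sets (C_borel \<Omega>)"
    and \<gamma>: "\<gamma> \<in> couplings \<Omega> Q1 Q2" and A: "A \<in> sets base_measure"
  shows "ennreal \<bar>measure (gibbs_mixture \<Omega> \<tau> Q1) A - measure (gibbs_mixture \<Omega> \<tau> Q2) A\<bar> * ennreal \<tau>
      \<le> (\<integral>\<^sup>+ (g1, g2). ennreal (sup_norm \<Omega> (\<lambda>x. g1 x - g2 x)) \<partial>\<gamma>)"
proof -
  define F where "F g = measure (gibbs \<Omega> \<tau> g) A" for g
  have sets: "sets \<gamma> = sets (C_borel \<Omega> \<Otimes>\<^sub>M C_borel \<Omega>)"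
    and dist: "distr \<gamma> (C_borel \<Omega>) fst = Q1" "distr \<gamma> (C_borel \<Omega>) snd = Q2"
    using \<gamma> by (auto simp: couplings_def)
  have sp: "space \<gamma> = C_space \<Omega> \<times> C_space \<Omega>"
    using sets_eq_imp_space_eq[OF sets] by (simp add: space_pair_measure space_C_borel)
  have meas: "fst \<in> measurable \<gamma> (C_borel \<Omega>)" "snd \<in> measurable \<gamma> (C_borel \<Omega>)"
    using measurable_cong_sets[OF sets refl] by auto
  note F [measurable] = measurable_measure_gibbs[OF A, folded F_def]
  note intF = integrable_measure_gibbs[OF _ _ A, folded F_def]
  have int: "integrable \<gamma> (\<lambda>z. F (fst z))" "integrable \<gamma> (\<lambda>z. F (snd z))"
    using intF[OF Q1] intF[OF Q2] unfolding dist[symmetric]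
    by (simp_all add: integrable_distr_eq meas F)
  \<comment> \<open>The marginals of \<open>\<gamma>\<close> turn the integrals under
    \<open>Q1\<close> and \<open>Q2\<close> into integrals under one measure, so the difference is a
    single integral of increments of \<open>F\<close>.\<close>
  have "measure (gibbs_mixture \<Omega> \<tau> Q1) A - measure (gibbs_mixture \<Omega> \<tau> Q2) A = (\<integral>z. F (fst z) - F (snd z) \<partial>\<gamma>)"
    unfolding measure_gibbs_mixture[OF Q1 A] measure_gibbs_mixture[OF Q2 A] F_def[symmetric]
    using int by (simp add: dist[symmetric] integral_distr meas F)
  then have "ennreal \<bar>measure (gibbs_mixture \<Omega> \<tau> Q1) A - measure (gibbs_mixture \<Omega> \<tau> Q2) A\<bar>
      \<le> (\<integral>\<^sup>+z. ennreal \<bar>F (fst z) - F (snd z)\<bar> \<partial>\<gamma>)"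
    using integral_norm_bound_ennreal[OF Bochner_Integration.integrable_diff[OF int]] by simp
  then have "ennreal \<bar>measure (gibbs_mixture \<Omega> \<tau> Q1) A - measure (gibbs_mixture \<Omega> \<tau> Q2) A\<bar> * ennreal \<tau>
      \<le> (\<integral>\<^sup>+z. ennreal \<bar>F (fst z) - F (snd z)\<bar> \<partial>\<gamma>) * ennreal \<tau>"
    by (intro mult_right_mono) auto
  also have "\<dots> = (\<integral>\<^sup>+z. ennreal \<bar>F (fst z) - F (snd z)\<bar> * ennreal \<tau> \<partial>\<gamma>)"
    using borel_measurable_integrable[OF Bochner_Integration.integrable_diff[OF int]]
    by (intro nn_integral_multc[symmetric]) auto
  also have "\<dots> \<le> (\<integral>\<^sup>+ (g1, g2). ennreal (sup_norm \<Omega> (\<lambda>x. g1 x - g2 x)) \<partial>\<gamma>)"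
  \<comment> \<open>On the space of \<open>\<gamma>\<close> both components lie in
    \<open>C_space \<Omega>\<close>, so the Lipschitz bound applies at every point.\<close>
  proof (intro nn_integral_mono, clarsimp simp: sp)
    fix f g assume "f \<in> C_space \<Omega>" "g \<in> C_space \<Omega>"
    then have "\<bar>F f - F g\<bar> * \<tau> \<le> sup_norm \<Omega> (\<lambda>x. f x - g x)"
      using abs_measure_gibbs_diff_le[of f g A] A \<tau> by (simp add: F_def field_simps)
    then show "ennreal \<bar>F f - F g\<bar> * ennreal \<tau> \<le> ennreal (sup_norm \<Omega> (\<lambda>x. f x - g x))"
      using \<tau> by (simp add: ennreal_leI flip: ennreal_mult)
  qed
  finally show ?thesis .
qed

text \<open>An infinite right-hand side is trivial. Otherwise the estimate for a fixed Borel set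
  holds for every coupling, hence for the infimum, and the resulting bound \<open>r\<close> is the
  same for all Borel sets, so it passes to the supremum.\<close>

lemma total_variation_gibbs_mixture_le:
  assumes Q1: "prob_space Q1" "sets Q1 = sets (C_borel \<Omega>)"
    and Q2: "prob_space Q2" "sets Q2 = sets (C_borel \<Omega>)"
  shows "ennreal (total_variation \<Omega> (gibbs_mixture \<Omega> \<tau> Q1) (gibbs_mixture \<Omega> \<tau> Q2))
           \<le> wasserstein_sup \<Omega> Q1 Q2 / ennreal \<tau>"
proof (cases "wasserstein_sup \<Omega> Q1 Q2 / ennreal \<tau>")
  case (real r)
  have "\<bar>measure (gibbs_mixture \<Omega> \<tau> Q1) A - measure (gibbs_mixture \<Omega> \<tau> Q2) A\<bar> \<le> r"
    if A: "A \<in> sets base_measure" for A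
  proof -
    have "ennreal \<bar>measure (gibbs_mixture \<Omega> \<tau> Q1) A - measure (gibbs_mixture \<Omega> \<tau> Q2) A\<bar> * ennreal \<tau>
        \<le> wasserstein_sup \<Omega> Q1 Q2"
      unfolding wasserstein_sup_def by (intro INF_greatest gibbs_mixture_diff_le_coupling Q1 Q2 A)
    \<comment> \<open>The factor \<open>\<tau>\<close> cancels in the extended reals because it is
      neither 0 nor infinite.\<close>
    from divide_right_mono_ennreal[OF this, of "ennreal \<tau>"]
    have "ennreal \<bar>measure (gibbs_mixture \<Omega> \<tau> Q1) A - measure (gibbs_mixture \<Omega> \<tau> Q2) A\<bar> \<le> ennreal r"
      using \<tau> by (simp add: real mult_divide_eq_ennreal)
    then show ?thesis using real by simp
  qed
  then have "total_variation \<Omega> (gibbs_mixture \<Omega> \<tau> Q1) (gibbs_mixture \<Omega> \<tau> Q2) \<le> r"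
    unfolding total_variation_def sets_base[symmetric]
    using sets.empty_sets by (intro cSUP_least) blast+
  then show ?thesis using real by (simp add: ennreal_leI)
qed simp

end

theorem lemma8:
  fixes \<Omega> :: "'a::euclidean_space set" and \<tau> :: real
  assumes "compact \<Omega>" and "convex \<Omega>" and "interior \<Omega> \<noteq> {}" and "\<tau> > 0"
  shows "(\<forall>g1\<in>C_space \<Omega>. \<forall>g2\<in>C_space \<Omega>.
            (\<forall>\<theta>\<in>\<Omega>. \<bar>ln (gibbs_density \<Omega> \<tau> g1 \<theta>) - ln (gibbs_density \<Omega> \<tau> g2 \<theta>)\<bar>
                     \<le> 2 * sup_norm \<Omega> (\<lambda>x. g1 x - g2 x) / \<tau>) \<and>
            total_variation \<Omega> (gibbs \<Omega> \<tau> g1) (gibbs \<Omega> \<tau> g2)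
              \<le> tanh (sup_norm \<Omega> (\<lambda>x. g1 x - g2 x) / \<tau>)) \<and>
         (\<forall>Q1 Q2.
            prob_space Q1 \<and> sets Q1 = sets (C_borel \<Omega>) \<and>
            (\<integral>\<^sup>+ g. ennreal (sup_norm \<Omega> g) \<partial>Q1) < \<infinity> \<and>
            prob_space Q2 \<and> sets Q2 = sets (C_borel \<Omega>) \<and>
            (\<integral>\<^sup>+ g. ennreal (sup_norm \<Omega> g) \<partial>Q2) < \<infinity> \<longrightarrow>
            ennreal (total_variation \<Omega> (gibbs_mixture \<Omega> \<tau> Q1) (gibbs_mixture \<Omega> \<tau> Q2))
              \<le> wasserstein_sup \<Omega> Q1 Q2 / ennreal \<tau>)"
  using total_variation_gibbs_le[OF assms(1,3,4)] abs_ln_gibbs_density_diff_le[OF assms(1,3,4)]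
    total_variation_gibbs_mixture_le[OF assms(1,3,4)]
  by blast

end
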